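(* Let $(\Omega,\mathcal H,\hat{\mathbb E})$ be a sublinear expectation space and let $X=(X_1,\dots,X_n)\in\mathcal H^n$ be an $n$-dimensional $G$-normal random vector, $X\sim\mathcal N(0,\Gamma)$. Suppose that there exists a permutation $\pi\in S_n$ such that for all $1\le i\le n-1$, $X_{\pi(i+1)}$ is independent from $(X_{\pi(1)},\dots,X_{\pi(i)})$. Then: (i) for $\underline\sigma_i^2,\overline\sigma_i^2$ such that $X_i\sim\mathcal N(0,[\underline\sigma_i^2,\overline\sigma_i^2])$ ($1\le i\le n$), $$\Gamma=\big\{\mathrm{diag}[r_1,\dots,r_n] : r_i\in[\underline\sigma_i^2,\overline\sigma_i^2]\big\};$$ (ii) for any $1\le i\le n$ such that $0<\underline\sigma_i^2<\overline\sigma_i^2$, $$\alpha[\underline\sigma_i^2,\overline\sigma_i^2]\ne[\underline\sigma_j^2,\overline\sigma_j^2]$$ for all $j\ne i$ and all $\alpha>0$; and (iii) for any $i<j$, $X_{\pi(i)}$ is not independent from $X_{\pi(j)}$ if either of the following holds: (a) $\underline\sigma_{\pi(i)}^2<\overline\sigma_{\pi(i)}^2$ and $0<\overline\sigma_{\pi(j)}^2$, or (b) $\underline\sigma_{\pi(j)}^2<\overline\sigma_{\pi(j)}^2$ and $0<\overline\sigma_{\pi(i)}^2$.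
   Context: $C_{l.Lip}(\mathbb R^n)$ is the set of functions $\varphi:\mathbb R^n\to\mathbb R$ for which there exist $C>0$ and $m\in\mathbb N$ with $|\varphi(x)-\varphi(y)|\le C(1+|x|^m+|y|^m)|x-y|$ for all $x,y\in\mathbb R^n$. Let $\Omega$ be a set and $\mathcal H$ a linear space of real-valued functions on $\Omega$ which contains all constants and contains $\varphi(X_1,\dots,X_n)$ whenever $X_1,\dots,X_n\in\mathcal H$ and $\varphi\in C_{l.Lip}(\mathbb R^n)$. A sublinear expectation is a map $\hat{\mathbb E}:\mathcal H\to\mathbb R$ such that: $\hat{\mathbb E}[X]\le\hat{\mathbb E}[Y]$ if $X\le Y$; $\hat{\mathbb E}[c]=c$ for $c\in\mathbb R$; $\hat{\mathbb E}[X+Y]\le\hat{\mathbb E}[X]+\hat{\mathbb E}[Y]$; $\hat{\mathbb E}[\lambda X]=\lambda\hat{\mathbb E}[X]$ for $\lambda\ge0$. Then $(\Omega,\mathcal H,\hat{\mathbb E})$ is a sublinear expectation space. Elements of $\mathcal H$ are random variables; elements of $\mathcal H^n$ are $n$-dimensional random vectors. Independence (possibly asymmetric): $Y\in\mathcal H^n$ is independent from $X\in\mathcal H^m$ if $\hat{\mathbb E}[\varphi(X,Y)]=\hat{\mathbb E}\big[\hat{\mathbb E}[\varphi(x,Y)]_{x=X}\big]$ for all $\varphi\in C_{l.Lip}(\mathbb R^{m+n})$. Identical distribution: $X,Y\in\mathcal H^n$ satisfy $X\sim Y$ if $\hat{\mathbb E}[\varphi(X)]=\hat{\mathbb E}[\varphi(Y)]$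 for all $\varphi\in C_{l.Lip}(\mathbb R^n)$. If $X\sim\bar X$ and $\bar X$ is independent from $X$, then $\bar X$ is an independent copy of $X$. $G$-normality: $X\in\mathcal H^n$ is $G$-normally distributed (a $G$-normal random vector) if $aX+b\bar X\sim\sqrt{a^2+b^2}\,X$ for all $a,b\ge0$ and any independent copy $\bar X$ of $X$. As usual the independent copy may live on an enlarged (product) sublinear expectation space, so the condition is never vacuous; it means exactly that $\hat{\mathbb E}\big[\hat{\mathbb E}[\varphi(ax+bX)]_{x=X}\big]=\hat{\mathbb E}[\varphi(\sqrt{a^2+b^2}\,X)]$ for all $a,b\ge0$ and $\varphi\in C_{l.Lip}(\mathbb R^n)$. For a bounded, closed, convex subset $\Gamma$ of the positive semidefinite symmetric $n\times n$ matrices, $X\sim\mathcal N(0,\Gamma)$ means that $X$ is an $n$-dimensional $G$-normal random vector with $\frac12\hat{\mathbb E}[\langle AX,X\rangle]=\frac12\sup_{B\in\Gamma}\mathrm{tr}[AB]$ for all symmetric $n\times n$ matrices $A$. ($\Gamma$ is uniquely determined by $X$, and determines the distribution of $X$.) If $n=1$, $\Gamma=[\underline\sigma^2,\overline\sigma^2]$ with $0\le\underline\sigma^2\le\overline\sigma^2$ given by $\overline\sigma^2=\hat{\mathbb E}[X^2]$ and $\underline\sigma^2=-\hat{\mathbb E}[-X^2]$. Each coordinate $X_i$ of a $G$-normal random vector is a $G$-normal random variable, so $X_i\sim\mathcal N(0,[\underline\sigma_i^2,\overline\sigma_i^2])$ with $\overline\sigma_i^2=\hat{\mathbb E}[X_i^2]$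 and $\underline\sigma_i^2=-\hat{\mathbb E}[-X_i^2]$. For $\alpha>0$, $\alpha[s,t]$ denotes the interval $[\alpha s,\alpha t]$. *)

theory Defs
  imports "HOL-Analysis.Analysis"
begin

text \<open>Dimensions vary within one statement here, so a vector with coordinates indexed by a finite set
  \<open>I\<close> is a function on the index type of which only the values on \<open>I\<close> matter; its Euclidean norm
  is \<open>L2_set x I\<close>. For a finite index type and \<open>I = UNIV\<close> this is the norm of \<open>real ^ 'n\<close>.

  The growth condition below ranges over all functions on the index type. It forces
  \<open>\<phi> x = \<phi> y\<close> whenever \<open>x\<close> and \<open>y\<close> agree on \<open>I\<close>, so the elements of \<open>C_lLip I\<close> are exactly the
  locally Lipschitz functions of the coordinates in \<open>I\<close>.\<close>

definition C_lLip :: "'i set \<Rightarrow> (('i \<Rightarrow> real) \<Rightarrow> real) set" where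
  "C_lLip I = {\<phi>. \<exists>C>0. \<exists>m::nat. \<forall>x y.
     \<bar>\<phi> x - \<phi> y\<bar> \<le> C * (1 + L2_set x I ^ m + L2_set y I ^ m) * L2_set (\<lambda>i. x i - y i) I}"

text \<open>The underlying set is the type \<open>'w\<close>. The expectation is a total function in HOL, but it is
  constrained only on \<open>H\<close>.\<close>

locale sublinear_expectation_space =
  fixes H :: "('w \<Rightarrow> real) set" and E :: "('w \<Rightarrow> real) \<Rightarrow> real"
  assumes const_mem: "(\<lambda>_. c) \<in> H"
    and add_mem: "X \<in> H \<Longrightarrow> Y \<in> H \<Longrightarrow> (\<lambda>\<omega>. X \<omega> + Y \<omega>) \<in> H"
    and scale_mem: "X \<in> H \<Longrightarrow> (\<lambda>\<omega>. c * X \<omega>) \<in> H"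
    and C_lLip_mem: "(\<And>i. i \<in> {1..n} \<Longrightarrow> Z i \<in> H) \<Longrightarrow> \<phi> \<in> C_lLip {1..n::nat} \<Longrightarrow>
           (\<lambda>\<omega>. \<phi> (\<lambda>i. Z i \<omega>)) \<in> H"
    and E_mono: "X \<in> H \<Longrightarrow> Y \<in> H \<Longrightarrow> (\<And>\<omega>. X \<omega> \<le> Y \<omega>) \<Longrightarrow> E X \<le> E Y"
    and E_const: "E (\<lambda>_. c) = c"
    and E_subadd: "X \<in> H \<Longrightarrow> Y \<in> H \<Longrightarrow> E (\<lambda>\<omega>. X \<omega> + Y \<omega>) \<le> E X + E Y"
    and E_pos_homogeneous: "X \<in> H \<Longrightarrow> 0 \<le> c \<Longrightarrow> E (\<lambda>\<omega>. c * X \<omega>) = c * E X"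

text \<open>\<open>independent_from E J Y I X\<close>: the vector \<open>(Y j)\<close>, \<open>j \<in> J\<close>, is independent from the vector
  \<open>(X i)\<close>, \<open>i \<in> I\<close>. The relation is not symmetric. The concatenated vector \<open>(X, Y)\<close> has the disjoint
  sum \<open>I <+> J\<close> as index set.\<close>

definition independent_from ::
  "(('w \<Rightarrow> real) \<Rightarrow> real) \<Rightarrow> 'j set \<Rightarrow> ('j \<Rightarrow> 'w \<Rightarrow> real) \<Rightarrow> 'i set \<Rightarrow> ('i \<Rightarrow> 'w \<Rightarrow> real) \<Rightarrow> bool" where
  "independent_from E J Y I X \<longleftrightarrow> (\<forall>\<phi>\<in>C_lLip (I <+> J).
     E (\<lambda>\<omega>. \<phi> (case_sum (\<lambda>i. X i \<omega>) (\<lambda>j. Y j \<omega>))) =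
     E (\<lambda>\<omega>'. E (\<lambda>\<omega>. \<phi> (case_sum (\<lambda>i. X i \<omega>') (\<lambda>j. Y j \<omega>)))))"

text \<open>\<open>a X + b X' \<sim> sqrt (a\<^sup>2 + b\<^sup>2) X\<close> for an independent copy \<open>X'\<close> of \<open>X\<close>, which may live on an enlarged
  (product) space. The inner expectation below is the one over the copy: for fixed \<open>x\<close> it only
  depends on the distribution of \<open>X'\<close>, which is that of \<open>X\<close>.\<close>

definition G_normal :: "(('w \<Rightarrow> real) \<Rightarrow> real) \<Rightarrow> 'i set \<Rightarrow> ('i \<Rightarrow> 'w \<Rightarrow> real) \<Rightarrow> bool" where
  "G_normal E I X \<longleftrightarrow> (\<forall>a\<ge>0. \<forall>b\<ge>0. \<forall>\<phi>\<in>C_lLip I.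
     E (\<lambda>\<omega>'. E (\<lambda>\<omega>. \<phi> (\<lambda>i. a * X i \<omega>' + b * X i \<omega>))) =
     E (\<lambda>\<omega>. \<phi> (\<lambda>i. sqrt (a\<^sup>2 + b\<^sup>2) * X i \<omega>)))"

definition pos_semidef :: "real ^ 'n ^ 'n \<Rightarrow> bool" where
  "pos_semidef B \<longleftrightarrow> transpose B = B \<and> (\<forall>x. 0 \<le> (B *v x) \<bullet> x)"

text \<open>\<open>X \<sim> N(0, \<Gamma>)\<close>. Nonemptiness of \<open>\<Gamma>\<close> is implicit in the supremum being a real number; it has to be
  stated because \<open>Sup {}\<close> is an unspecified real in HOL.\<close>

definition normal_distributed ::
  "(('w \<Rightarrow> real) \<Rightarrow> real) \<Rightarrow> ('n::finite \<Rightarrow> 'w \<Rightarrow> real) \<Rightarrow> (real ^ 'n ^ 'n) set \<Rightarrow> bool" where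
  "normal_distributed E X \<Gamma> \<longleftrightarrow>
     \<Gamma> \<noteq> {} \<and> bounded \<Gamma> \<and> closed \<Gamma> \<and> convex \<Gamma> \<and> (\<forall>B\<in>\<Gamma>. pos_semidef B) \<and>
     G_normal E UNIV X \<and>
     (\<forall>A. transpose A = A \<longrightarrow>
        1/2 * E (\<lambda>\<omega>. (A *v (\<chi> i. X i \<omega>)) \<bullet> (\<chi> i. X i \<omega>)) = 1/2 * (SUP B\<in>\<Gamma>. trace (A ** B)))"

definition upper_variance :: "(('w \<Rightarrow> real) \<Rightarrow> real) \<Rightarrow> ('w \<Rightarrow> real) \<Rightarrow> real" where
  "upper_variance E Z = E (\<lambda>\<omega>. (Z \<omega>)\<^sup>2)"

definition lower_variance :: "(('w \<Rightarrow> real) \<Rightarrow> real) \<Rightarrow> ('w \<Rightarrow> real) \<Rightarrow> real" where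
  "lower_variance E Z = - E (\<lambda>\<omega>. - (Z \<omega>)\<^sup>2)"

end

theory Submission imports Defs begin

text \<open>
  Why the theorem is true. A coordinate of a \<open>G\<close>-normal vector has no mean uncertainty:
  \<open>X + X' \<sim> sqrt 2 X\<close> forces \<open>E[X\<^sub>i] = E[-X\<^sub>i] = 0\<close>. Hence a term \<open>d X\<^sub>i\<close>, \<open>d\<close> a constant, can be dropped from inside any
  expectation (\<open>E_add_centred\<close>).

  Part (i). Conditioning on the earlier coordinates, the cross terms of \<open>\<langle>AX, X\<rangle>\<close> are linear in the last
  coordinate and drop out; the squares contribute separately. So
  \<open>E\<langle>AX, X\<rangle> = \<Sum>\<^sub>i E[A\<^sub>i\<^sub>i X\<^sub>i\<^sup>2]\<close> (\<open>E_quadratic_form_independent\<close>), which is the support function of the box of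
  diagonal matrices. A closed convex set is determined by its support function
  (\<open>box_of_diagonal_matrices_eqI\<close>).

  Parts (ii) and (iii) both follow from one obstruction, \<open>G_normal_independent_imp_certain_variance\<close>:
  if \<open>Y\<close>, \<open>Z\<close> are coordinates of a \<open>G\<close>-normal vector, \<open>Z\<close> is independent from \<open>Y\<close> and \<open>Y\<close> is not
  degenerate, then \<open>Z\<close> has no variance uncertainty. The proof tests \<open>G\<close>-normality with \<open>y z\<^sup>2\<close>.
  Let \<open>g c = E[c Z\<^sup>2]\<close>, a sublinear function of \<open>c\<close>, and \<open>m = E[g Y] = E[Y Z\<^sup>2]\<close>. On one hand
  \<open>E[(sqrt 2 Y) (sqrt 2 Z)\<^sup>2] = 2 sqrt 2 m\<close>. On the other hand, for an independent copy \<open>(Y', Z')\<close>,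
  integrating first over the copy turns \<open>(Y + Y') (Z + Z')\<^sup>2\<close> into \<open>Y Z\<^sup>2 + h Y\<close> with
  \<open>h y = E[g (y + Y)]\<close>, and integrating this gives at most
  \<open>E[g Y] + E[h Y] = m + E[g (sqrt 2 Y)] = (1 + sqrt 2) m\<close>. Thus \<open>2 sqrt 2 m \<le> (1 + sqrt 2) m\<close>, so
  \<open>m \<le> 0\<close>. But \<open>g c\<close> is \<open>(upper - lower variance of Z) * max c 0\<close> plus a linear term, so
  \<open>m\<close> is that difference times \<open>E[max Y 0]\<close>, and \<open>E[max Y 0] > 0\<close> unless \<open>Y\<close> is degenerate.

  In (ii), of the two coordinates \<open>i\<close> and \<open>j\<close> one is independent from the other, and both would be
  nondegenerate with uncertain variance. In (iii), the obstruction applied to the given order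
  excludes (b), and applied to the reversed order it excludes (a).
\<close>

section \<open>Locally Lipschitz functions of polynomial growth\<close>

text \<open>The weight \<open>(1 + |x| + |y|) ^ m\<close> is equivalent to \<open>1 + |x| ^ m + |y| ^ m\<close> up to constants, and it is
  increasing in \<open>m\<close>, and the product of two such weights is again one. These two properties make
  sums and products of test functions easy to bound.\<close>

lemma C_lLip_iff:
  "\<phi> \<in> C_lLip I \<longleftrightarrow> (\<exists>C>0. \<exists>m. \<forall>x y.
     \<bar>\<phi> x - \<phi> y\<bar> \<le> C * (1 + L2_set x I + L2_set y I) ^ m * L2_set (\<lambda>i. x i - y i) I)"
proof -
  have w1: "1 + a ^ m + b ^ m \<le> 3 * (1 + a + b) ^ m" if "0 \<le> a" "0 \<le> b" for a b :: real and m :: nat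
  proof -
    have "1 \<le> (1 + a + b) ^ m" "a ^ m \<le> (1 + a + b) ^ m" "b ^ m \<le> (1 + a + b) ^ m"
      using that by (auto intro!: one_le_power power_mono)
    then show ?thesis by linarith
  qed
  have w2: "(1 + a + b) ^ m \<le> 3 ^ m * (1 + a ^ m + b ^ m)" if "0 \<le> a" "0 \<le> b" for a b :: real and m :: nat
  proof -
    have "(1 + a + b) ^ m \<le> (3 * max 1 (max a b)) ^ m"
      using that by (intro power_mono) auto
    also have "\<dots> = 3 ^ m * max 1 (max a b) ^ m" by (simp add: power_mult_distrib)
    also have "max 1 (max a b) ^ m \<le> 1 + a ^ m + b ^ m"
      using that by (auto simp: max_def)
    finally show ?thesis by simp
  qed
  show ?thesis
  proof
    assume "\<phi> \<in> C_lLip I"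
    then obtain C m where C: "C > 0" and le: "\<And>x y. \<bar>\<phi> x - \<phi> y\<bar> \<le>
        C * (1 + L2_set x I ^ m + L2_set y I ^ m) * L2_set (\<lambda>i. x i - y i) I"
      unfolding C_lLip_def by blast
    have "\<bar>\<phi> x - \<phi> y\<bar> \<le> (C * 3) * (1 + L2_set x I + L2_set y I) ^ m * L2_set (\<lambda>i. x i - y i) I" for x y
    proof -
      have "C * (1 + L2_set x I ^ m + L2_set y I ^ m) * L2_set (\<lambda>i. x i - y i) I
          \<le> C * (3 * (1 + L2_set x I + L2_set y I) ^ m) * L2_set (\<lambda>i. x i - y i) I"
        using C by (intro mult_right_mono mult_left_mono w1) auto
      with le[of x y] show ?thesis by (simp add: mult.assoc)
    qed
    moreover have "C * 3 > 0" using C by simp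
    ultimately show "\<exists>C>0. \<exists>m. \<forall>x y.
     \<bar>\<phi> x - \<phi> y\<bar> \<le> C * (1 + L2_set x I + L2_set y I) ^ m * L2_set (\<lambda>i. x i - y i) I" by blast
  next
    assume "\<exists>C>0. \<exists>m. \<forall>x y.
     \<bar>\<phi> x - \<phi> y\<bar> \<le> C * (1 + L2_set x I + L2_set y I) ^ m * L2_set (\<lambda>i. x i - y i) I"
    then obtain C m where C: "C > 0" and le: "\<And>x y. \<bar>\<phi> x - \<phi> y\<bar> \<le>
        C * (1 + L2_set x I + L2_set y I) ^ m * L2_set (\<lambda>i. x i - y i) I"
      by blast
    have "\<bar>\<phi> x - \<phi> y\<bar> \<le> (C * 3 ^ m) * (1 + L2_set x I ^ m + L2_set y I ^ m) * L2_set (\<lambda>i. x i - y i) I" for x y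
    proof -
      have "C * (1 + L2_set x I + L2_set y I) ^ m * L2_set (\<lambda>i. x i - y i) I
          \<le> C * (3 ^ m * (1 + L2_set x I ^ m + L2_set y I ^ m)) * L2_set (\<lambda>i. x i - y i) I"
        using C by (intro mult_right_mono mult_left_mono w2) auto
      with le[of x y] show ?thesis by (simp add: mult.assoc)
    qed
    moreover have "C * 3 ^ m > 0" using C by simp
    ultimately show "\<phi> \<in> C_lLip I" unfolding C_lLip_def by blast
  qed
qed

lemma C_lLipE:
  assumes "\<phi> \<in> C_lLip I"
  obtains C m where "C > 0" "\<And>x y k. m \<le> k \<Longrightarrow>
     \<bar>\<phi> x - \<phi> y\<bar> \<le> C * (1 + L2_set x I + L2_set y I) ^ k * L2_set (\<lambda>i. x i - y i) I"
proof -
  obtain C m where C: "C > 0" and le: "\<And>x y. \<bar>\<phi> x - \<phi> y\<bar> \<le>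
        C * (1 + L2_set x I + L2_set y I) ^ m * L2_set (\<lambda>i. x i - y i) I"
    using assms unfolding C_lLip_iff by blast
  have "\<bar>\<phi> x - \<phi> y\<bar> \<le> C * (1 + L2_set x I + L2_set y I) ^ k * L2_set (\<lambda>i. x i - y i) I"
    if "m \<le> k" for x y k
  proof -
    have "C * (1 + L2_set x I + L2_set y I) ^ m * L2_set (\<lambda>i. x i - y i) I
       \<le> C * (1 + L2_set x I + L2_set y I) ^ k * L2_set (\<lambda>i. x i - y i) I"
      using C that by (intro mult_right_mono mult_left_mono power_increasing) auto
    with le[of x y] show ?thesis by linarith
  qed
  with C show ?thesis using that by blast
qed

lemma C_lLip_const: "(\<lambda>_. c) \<in> C_lLip I"
  unfolding C_lLip_def by (auto intro!: exI[of _ 1])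

lemma C_lLip_coord:
  assumes "finite I" "i \<in> I"
  shows "(\<lambda>x. x i) \<in> C_lLip I"
proof -
  have "\<bar>x i - y i\<bar> \<le> 1 * (1 + L2_set x I + L2_set y I) ^ 0 * L2_set (\<lambda>i. x i - y i) I" for x y
    using member_le_L2_set[OF assms, of "\<lambda>i. \<bar>x i - y i\<bar>"] by (simp add: L2_set_def)
  then show ?thesis unfolding C_lLip_iff by (meson zero_less_one)
qed

lemma C_lLip_add:
  assumes "\<phi> \<in> C_lLip I" "\<psi> \<in> C_lLip I"
  shows "(\<lambda>x. \<phi> x + \<psi> x) \<in> C_lLip I"
proof -
  obtain C m where C: "C > 0" "\<And>x y k. m \<le> k \<Longrightarrow>
     \<bar>\<phi> x - \<phi> y\<bar> \<le> C * (1 + L2_set x I + L2_set y I) ^ k * L2_set (\<lambda>i. x i - y i) I"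
    using C_lLipE[OF assms(1)] by metis
  obtain D l where D: "D > 0" "\<And>x y k. l \<le> k \<Longrightarrow>
     \<bar>\<psi> x - \<psi> y\<bar> \<le> D * (1 + L2_set x I + L2_set y I) ^ k * L2_set (\<lambda>i. x i - y i) I"
    using C_lLipE[OF assms(2)] by metis
  have "\<bar>(\<phi> x + \<psi> x) - (\<phi> y + \<psi> y)\<bar> \<le>
     (C + D) * (1 + L2_set x I + L2_set y I) ^ (m + l) * L2_set (\<lambda>i. x i - y i) I" for x y
    using C(2)[of "m + l" x y] D(2)[of "m + l" x y] by (simp add: distrib_right)
  moreover have "C + D > 0" using C D by simp
  ultimately show ?thesis unfolding C_lLip_iff by blast
qed

lemma C_lLip_growth:
  assumes "\<phi> \<in> C_lLip I"
  obtains C m where "C > 0" "\<And>x. \<bar>\<phi> x\<bar> \<le> C * (1 + L2_set x I) ^ m"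
proof -
  obtain C m where C: "C > 0" "\<And>x y k. m \<le> k \<Longrightarrow>
     \<bar>\<phi> x - \<phi> y\<bar> \<le> C * (1 + L2_set x I + L2_set y I) ^ k * L2_set (\<lambda>i. x i - y i) I"
    using C_lLipE[OF assms] by metis
  have "\<bar>\<phi> x\<bar> \<le> (C + \<bar>\<phi> (\<lambda>_. 0)\<bar>) * (1 + L2_set x I) ^ Suc m" for x
  proof -
    have z: "L2_set (\<lambda>i. 0) I = 0" by (simp add: L2_set_def)
    have "\<bar>\<phi> x - \<phi> (\<lambda>_. 0)\<bar> \<le> C * (1 + L2_set x I) ^ m * L2_set x I"
      using C(2)[of m x "\<lambda>_. 0"] by (simp add: z)
    also have "\<dots> \<le> C * (1 + L2_set x I) ^ m * (1 + L2_set x I)"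
      using C by (intro mult_left_mono) auto
    finally have "\<bar>\<phi> x - \<phi> (\<lambda>_. 0)\<bar> \<le> C * (1 + L2_set x I) ^ Suc m" by (simp add: ac_simps)
    moreover have "\<bar>\<phi> (\<lambda>_. 0)\<bar> * 1 \<le> \<bar>\<phi> (\<lambda>_. 0)\<bar> * (1 + L2_set x I) ^ Suc m"
      by (intro mult_left_mono one_le_power) auto
    ultimately show ?thesis by (simp only: distrib_right)
  qed
  moreover have "C + \<bar>\<phi> (\<lambda>_. 0)\<bar> > 0" using C by simp
  ultimately show ?thesis using that by blast
qed

lemma C_lLip_mult:
  assumes "\<phi> \<in> C_lLip I" "\<psi> \<in> C_lLip I"
  shows "(\<lambda>x. \<phi> x * \<psi> x) \<in> C_lLip I"
proof -
  obtain C m where C: "C > 0" "\<And>x y k. m \<le> k \<Longrightarrow>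
     \<bar>\<phi> x - \<phi> y\<bar> \<le> C * (1 + L2_set x I + L2_set y I) ^ k * L2_set (\<lambda>i. x i - y i) I"
    using C_lLipE[OF assms(1)] by metis
  obtain D l where D: "D > 0" "\<And>x y k. l \<le> k \<Longrightarrow>
     \<bar>\<psi> x - \<psi> y\<bar> \<le> D * (1 + L2_set x I + L2_set y I) ^ k * L2_set (\<lambda>i. x i - y i) I"
    using C_lLipE[OF assms(2)] by metis
  obtain A a where A: "A > 0" "\<And>x. \<bar>\<phi> x\<bar> \<le> A * (1 + L2_set x I) ^ a"
    using C_lLip_growth[OF assms(1)] by metis
  obtain B b where B: "B > 0" "\<And>x. \<bar>\<psi> x\<bar> \<le> B * (1 + L2_set x I) ^ b"
    using C_lLip_growth[OF assms(2)] by metis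
  have "\<bar>\<phi> x * \<psi> x - \<phi> y * \<psi> y\<bar> \<le>
     (A * D + B * C) * (1 + L2_set x I + L2_set y I) ^ (a + b + m + l) * L2_set (\<lambda>i. x i - y i) I" for x y
  proof -
    define w where "w = 1 + L2_set x I + L2_set y I"
    define d where "d = L2_set (\<lambda>i. x i - y i) I"
    have w: "1 \<le> w" and d: "0 \<le> d" unfolding w_def d_def by auto
    have "\<bar>\<phi> x\<bar> \<le> A * w ^ a"
      by (rule order_trans[OF A(2)]) (use A(1) in \<open>auto simp: w_def intro!: mult_left_mono power_mono\<close>)
    moreover have "\<bar>\<psi> y\<bar> \<le> B * w ^ b"
      by (rule order_trans[OF B(2)]) (use B(1) in \<open>auto simp: w_def intro!: mult_left_mono power_mono\<close>)
    moreover have "\<phi> x * \<psi> x - \<phi> y * \<psi> y = \<phi> x * (\<psi> x - \<psi> y) + \<psi> y * (\<phi> x - \<phi> y)"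
      by (simp add: algebra_simps)
    moreover have "\<bar>\<psi> x - \<psi> y\<bar> \<le> D * w ^ (b + m + l) * d"
      using D(2)[of "b + m + l" x y] by (simp add: w_def d_def)
    moreover have "\<bar>\<phi> x - \<phi> y\<bar> \<le> C * w ^ (a + m + l) * d"
      using C(2)[of "a + m + l" x y] by (simp add: w_def d_def)
    ultimately have "\<bar>\<phi> x * \<psi> x - \<phi> y * \<psi> y\<bar> \<le>
        A * w ^ a * (D * w ^ (b + m + l) * d) + B * w ^ b * (C * w ^ (a + m + l) * d)"
      by (simp only:, intro order_trans[OF abs_triangle_ineq] add_mono)
        (auto simp only: abs_mult intro!: mult_mono order_trans[OF abs_ge_zero])
    also have "\<dots> = (A * D + B * C) * w ^ (a + b + m + l) * d"
      by (simp add: power_add algebra_simps)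
    finally show ?thesis by (simp only: w_def d_def)
  qed
  moreover have "A * D + B * C > 0" using A B C D by (simp add: add_pos_pos)
  ultimately show ?thesis unfolding C_lLip_iff by blast
qed

lemma C_lLip_lipschitz_comp:
  assumes f: "\<And>s t::real. \<bar>f s - f t\<bar> \<le> L * \<bar>s - t\<bar>" and "\<phi> \<in> C_lLip I"
  shows "(\<lambda>x. f (\<phi> x) :: real) \<in> C_lLip I"
proof -
  obtain C m where C: "C > 0" "\<And>x y k. m \<le> k \<Longrightarrow>
     \<bar>\<phi> x - \<phi> y\<bar> \<le> C * (1 + L2_set x I + L2_set y I) ^ k * L2_set (\<lambda>i. x i - y i) I"
    using C_lLipE[OF assms(2)] by metis
  have L: "0 \<le> L" using f[of 1 0] by simp
  have "\<bar>f (\<phi> x) - f (\<phi> y)\<bar> \<le>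
     ((L + 1) * C) * (1 + L2_set x I + L2_set y I) ^ m * L2_set (\<lambda>i. x i - y i) I" for x y
  proof -
    have "\<bar>f (\<phi> x) - f (\<phi> y)\<bar> \<le> (L + 1) * \<bar>\<phi> x - \<phi> y\<bar>"
      using f[of "\<phi> x" "\<phi> y"] by (simp add: distrib_right)
    also have "\<dots> \<le> (L + 1) * (C * (1 + L2_set x I + L2_set y I) ^ m * L2_set (\<lambda>i. x i - y i) I)"
      using L C(2)[of m x y] by (intro mult_left_mono) auto
    finally show ?thesis by (simp add: mult.assoc)
  qed
  moreover have "(L + 1) * C > 0" using L C by simp
  ultimately show ?thesis unfolding C_lLip_iff by blast
qed

lemma C_lLip_sum:
  "(\<And>a. a \<in> A \<Longrightarrow> \<phi> a \<in> C_lLip I) \<Longrightarrow> (\<lambda>x. \<Sum>a\<in>A. \<phi> a x) \<in> C_lLip I"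
  by (induction A rule: infinite_finite_induct) (auto intro: C_lLip_const C_lLip_add)

lemma C_lLip_mono:
  assumes "I \<subseteq> J" "finite J"
  shows "C_lLip I \<subseteq> C_lLip J"
proof
  fix \<phi> assume "\<phi> \<in> C_lLip I"
  then obtain C m where C: "C > 0" "\<And>x y k. m \<le> k \<Longrightarrow>
     \<bar>\<phi> x - \<phi> y\<bar> \<le> C * (1 + L2_set x I + L2_set y I) ^ k * L2_set (\<lambda>i. x i - y i) I"
    using C_lLipE by metis
  have le: "L2_set x I \<le> L2_set x J" for x
    unfolding L2_set_def using assms by (intro real_sqrt_le_mono sum_mono2) auto
  have "\<bar>\<phi> x - \<phi> y\<bar> \<le> C * (1 + L2_set x J + L2_set y J) ^ m * L2_set (\<lambda>i. x i - y i) J" for x y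
  proof -
    have "C * (1 + L2_set x I + L2_set y I) ^ m * L2_set (\<lambda>i. x i - y i) I
       \<le> C * (1 + L2_set x J + L2_set y J) ^ m * L2_set (\<lambda>i. x i - y i) J"
      using C(1) le by (intro mult_mono mult_left_mono power_mono add_mono) auto
    with C(2)[of m x y] show ?thesis by linarith
  qed
  with C(1) show "\<phi> \<in> C_lLip J" unfolding C_lLip_iff by blast
qed

text \<open>The map \<open>g\<close> transports a vector along \<open>f\<close> from the index set \<open>I\<close> to \<open>f ` I\<close> without changing its
  norm. It is left arbitrary off \<open>f ` I\<close>, so that any inverse of \<open>f\<close> on \<open>I\<close> may be used to build it.\<close>

lemma C_lLip_reindex:
  assumes f: "inj_on f I" and "\<phi> \<in> C_lLip (f ` I)"
    and g: "\<And>x i. i \<in> I \<Longrightarrow> g x (f i) = x i"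
  shows "(\<lambda>x. \<phi> (g x)) \<in> C_lLip I"
proof -
  have 1: "L2_set (g x) (f ` I) = L2_set x I" for x
    unfolding L2_set_def by (simp add: sum.reindex[OF f] g)
  have 2: "L2_set (\<lambda>i. g x i - g y i) (f ` I) = L2_set (\<lambda>i. x i - y i) I" for x y
    unfolding L2_set_def by (simp add: sum.reindex[OF f] g)
  obtain C m where C: "C > 0" and le: "\<And>x y. \<bar>\<phi> x - \<phi> y\<bar> \<le>
      C * (1 + L2_set x (f ` I) ^ m + L2_set y (f ` I) ^ m) * L2_set (\<lambda>i. x i - y i) (f ` I)"
    using assms(2) unfolding C_lLip_def by blast
  have "\<bar>\<phi> (g x) - \<phi> (g y)\<bar> \<le> C * (1 + L2_set x I ^ m + L2_set y I ^ m) * L2_set (\<lambda>i. x i - y i) I" for x y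
    using le[of "g x" "g y"] unfolding 1 2 .
  with C show ?thesis unfolding C_lLip_def by blast
qed

section \<open>Test functions for independence and G-normality\<close>

lemma G_normal_twice:
  assumes "G_normal E S X" "\<phi> \<in> C_lLip S"
  shows "E (\<lambda>\<omega>'. E (\<lambda>\<omega>. \<phi> (\<lambda>i. X i \<omega>' + X i \<omega>))) = E (\<lambda>\<omega>. \<phi> (\<lambda>i. sqrt 2 * X i \<omega>))"
  using assms(1)[unfolded G_normal_def, rule_format, of 1 1, OF _ _ assms(2)] by simp

lemma independent_from_mono:
  assumes "independent_from E J Y I X" "I' \<subseteq> I" "J' \<subseteq> J" "finite I" "finite J"
  shows "independent_from E J' Y I' X"
proof -
  have "C_lLip (I' <+> J') \<subseteq> C_lLip (I <+> J)"
    using assms by (intro C_lLip_mono) auto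
  then show ?thesis using assms(1) unfolding independent_from_def by blast
qed

lemma independent_from_pairD:
  assumes "independent_from E {j} Y {i} X"
    and "(\<lambda>x. f (x (Inl i)) (x (Inr j))) \<in> C_lLip ({i} <+> {j})"
  shows "E (\<lambda>\<omega>. f (X i \<omega>) (Y j \<omega>)) = E (\<lambda>\<omega>'. E (\<lambda>\<omega>. f (X i \<omega>') (Y j \<omega>)))"
  using assms unfolding independent_from_def by fastforce

section \<open>Calculus of a sublinear expectation\<close>

context sublinear_expectation_space
begin

text \<open>Enumerating \<open>I\<close> reduces this to the index sets \<open>{1..n}\<close> of the defining closure property.\<close>

lemma C_lLip_mem_finite:
  assumes "finite I" "\<And>i. i \<in> I \<Longrightarrow> Z i \<in> H" "\<phi> \<in> C_lLip I"
  shows "(\<lambda>\<omega>. \<phi> (\<lambda>i. Z i \<omega>)) \<in> H"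
proof -
  obtain f where f: "bij_betw f {1..card I} I"
    using assms(1) by (metis bij_betw_iff_card card_atLeastAtMost diff_Suc_1 finite_atLeastAtMost)
  define h where "h = inv_into {1..card I} f"
  have h: "h (f k) = k" if "k \<in> {1..card I}" for k
    using that f unfolding h_def by (simp add: bij_betw_def)
  have fh: "f (h i) = i" if "i \<in> I" for i
    using that f unfolding h_def by (metis bij_betw_inv_into_right)
  have "(\<lambda>x. \<phi> (\<lambda>i. x (h i))) \<in> C_lLip {1..card I}"
    using f assms(3) by (intro C_lLip_reindex[of f _ \<phi>]) (auto simp: bij_betw_def h)
  moreover have "Z (f k) \<in> H" if "k \<in> {1..card I}" for k
    using assms(2) bij_betwE[OF f] that by blast
  ultimately have "(\<lambda>\<omega>. \<phi> (\<lambda>i. Z (f (h i)) \<omega>)) \<in> H"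
    using C_lLip_mem[of "card I" "\<lambda>k. Z (f k)"] by blast
  moreover have "\<phi> (\<lambda>i. Z (f (h i)) \<omega>) = \<phi> (\<lambda>i. Z i \<omega>)" for \<omega>
  proof -
    have z: "L2_set (\<lambda>i. Z (f (h i)) \<omega> - Z i \<omega>) I = 0"
      by (simp add: L2_set_def fh)
    obtain C m where C: "\<And>x y. \<bar>\<phi> x - \<phi> y\<bar> \<le>
      C * (1 + L2_set x I ^ m + L2_set y I ^ m) * L2_set (\<lambda>i. x i - y i) I"
      using assms(3) unfolding C_lLip_def by blast
    show ?thesis using C[of "\<lambda>i. Z (f (h i)) \<omega>" "\<lambda>i. Z i \<omega>"] by (simp add: z)
  qed
  ultimately show ?thesis by simp
qed

lemma lipschitz_mem:
  assumes "\<And>s t::real. \<bar>f s - f t\<bar> \<le> L * \<bar>s - t\<bar>" "X \<in> H"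
  shows "(\<lambda>\<omega>. f (X \<omega>)) \<in> H"
  using C_lLip_mem_finite[of "{()}" "\<lambda>_. X" "\<lambda>x. f (x ())"] assms
    C_lLip_lipschitz_comp[of f L "\<lambda>x. x ()" "{()}"] C_lLip_coord[of "{()}" "()"] by simp

lemma mult_mem:
  assumes "X \<in> H" "Y \<in> H"
  shows "(\<lambda>\<omega>. X \<omega> * Y \<omega>) \<in> H"
  using C_lLip_mem_finite[of UNIV "\<lambda>b. if b then X else Y" "\<lambda>x. x True * x False"] assms
    C_lLip_mult[OF C_lLip_coord[of UNIV True] C_lLip_coord[of UNIV False]] by simp

lemma pos_part_mem: "X \<in> H \<Longrightarrow> (\<lambda>\<omega>. max (X \<omega>) 0) \<in> H"
  by (rule lipschitz_mem[of "\<lambda>t. max t 0" 1]) auto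

lemma uminus_mem: "X \<in> H \<Longrightarrow> (\<lambda>\<omega>. - X \<omega>) \<in> H"
  using scale_mem[of X "-1"] by simp

lemma sum_mem:
  "(\<And>a. a \<in> A \<Longrightarrow> Z a \<in> H) \<Longrightarrow> (\<lambda>\<omega>. \<Sum>a\<in>A. Z a \<omega>) \<in> H"
  by (induction A rule: infinite_finite_induct) (auto intro: const_mem add_mem)

lemmas H_intros = const_mem add_mem mult_mem uminus_mem pos_part_mem sum_mem

lemma E_add_const:
  assumes "X \<in> H"
  shows "E (\<lambda>\<omega>. c + X \<omega>) = c + E X"
proof (rule antisym)
  show "E (\<lambda>\<omega>. c + X \<omega>) \<le> c + E X"
    using E_subadd[OF const_mem assms, of c] by (simp add: E_const)
  have "E (\<lambda>\<omega>. - c + (c + X \<omega>)) \<le> - c + E (\<lambda>\<omega>. c + X \<omega>)"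
    using E_subadd[OF const_mem add_mem[OF const_mem assms], of "- c" c] by (simp add: E_const)
  then show "c + E X \<le> E (\<lambda>\<omega>. c + X \<omega>)" by simp
qed

lemma E_scale_centred:
  assumes "Z \<in> H" "E Z = 0" "E (\<lambda>\<omega>. - Z \<omega>) = 0"
  shows "E (\<lambda>\<omega>. d * Z \<omega>) = 0"
proof (cases "0 \<le> d")
  case True
  then show ?thesis using assms by (simp add: E_pos_homogeneous)
next
  case False
  then show ?thesis using assms E_pos_homogeneous[of "\<lambda>\<omega>. - Z \<omega>" "- d"] by (simp add: uminus_mem)
qed

text \<open>Subadditivity used twice, to add and to remove \<open>d Z\<close>. Hence a variable without mean uncertainty
  behaves linearly under \<open>E\<close>, whatever the sign of \<open>d\<close>.\<close>

lemma E_add_centred: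
  assumes "W \<in> H" "Z \<in> H" "E Z = 0" "E (\<lambda>\<omega>. - Z \<omega>) = 0"
  shows "E (\<lambda>\<omega>. W \<omega> + d * Z \<omega>) = E W"
proof (rule antisym)
  show "E (\<lambda>\<omega>. W \<omega> + d * Z \<omega>) \<le> E W"
    using E_subadd[of W "\<lambda>\<omega>. d * Z \<omega>"] assms E_scale_centred[of Z d] by (simp add: scale_mem)
  have "E (\<lambda>\<omega>. (W \<omega> + d * Z \<omega>) + (- d) * Z \<omega>) \<le> E (\<lambda>\<omega>. W \<omega> + d * Z \<omega>) + E (\<lambda>\<omega>. (- d) * Z \<omega>)"
    using assms by (intro E_subadd H_intros)
  then show "E W \<le> E (\<lambda>\<omega>. W \<omega> + d * Z \<omega>)"
    using E_scale_centred[of Z "- d"] assms by simp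
qed

text \<open>Written in this form, the nonlinearity in \<open>c\<close> is a multiple of \<open>max c 0\<close>, and the factor in front
  of it is the variance uncertainty.\<close>

lemma E_scaled_square:
  assumes "Z \<in> H"
  shows "E (\<lambda>\<omega>. c * (Z \<omega>)\<^sup>2) =
    lower_variance E Z * c + (upper_variance E Z - lower_variance E Z) * max c 0"
proof -
  have 1: "(\<lambda>\<omega>. (Z \<omega>)\<^sup>2) \<in> H" unfolding power2_eq_square using assms by (intro H_intros)
  show ?thesis
  proof (cases "0 \<le> c")
    case True
    then show ?thesis using E_pos_homogeneous[OF 1, of c]
      by (simp add: upper_variance_def lower_variance_def algebra_simps)
  next
    case False
    then show ?thesis using E_pos_homogeneous[OF uminus_mem[OF 1], of "- c"]
      by (simp add: lower_variance_def)
  qed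
qed

lemma lower_variance_nonneg:
  assumes "Z \<in> H" shows "0 \<le> lower_variance E Z"
proof -
  have "(\<lambda>\<omega>. - (Z \<omega>)\<^sup>2) \<in> H" unfolding power2_eq_square by (intro H_intros assms)
  from E_mono[OF this const_mem, of 0] show ?thesis by (simp add: lower_variance_def E_const)
qed

lemma lower_le_upper_variance:
  assumes "Z \<in> H" shows "lower_variance E Z \<le> upper_variance E Z"
proof -
  have 1: "(\<lambda>\<omega>. (Z \<omega>)\<^sup>2) \<in> H" unfolding power2_eq_square using assms by (intro H_intros)
  have "E (\<lambda>\<omega>. (Z \<omega>)\<^sup>2 + - (Z \<omega>)\<^sup>2) \<le> E (\<lambda>\<omega>. (Z \<omega>)\<^sup>2) + E (\<lambda>\<omega>. - (Z \<omega>)\<^sup>2)"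
    using 1 by (intro E_subadd H_intros)
  then show ?thesis by (simp add: lower_variance_def upper_variance_def E_const)
qed

text \<open>A function obtained by an inner expectation is thus again Lipschitz, hence admissible as a test
  function for the outer one.\<close>

lemma E_shift_lipschitz:
  assumes f: "\<And>s t::real. \<bar>f s - f t\<bar> \<le> L * \<bar>s - t\<bar>" and Y: "Y \<in> H"
  shows "\<bar>E (\<lambda>\<omega>. f (s + Y \<omega>)) - E (\<lambda>\<omega>. f (t + Y \<omega>))\<bar> \<le> L * \<bar>s - t\<bar>"
proof -
  have mem: "(\<lambda>\<omega>. f (t + Y \<omega>)) \<in> H" for t
    by (rule lipschitz_mem[OF f]) (intro H_intros Y)
  have le: "E (\<lambda>\<omega>. f (s + Y \<omega>)) \<le> L * \<bar>s - t\<bar> + E (\<lambda>\<omega>. f (t + Y \<omega>))" for s t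
  proof -
    have "f (s + Y \<omega>) \<le> L * \<bar>s - t\<bar> + f (t + Y \<omega>)" for \<omega>
      using f[of "s + Y \<omega>" "t + Y \<omega>"] by simp
    then have "E (\<lambda>\<omega>. f (s + Y \<omega>)) \<le> E (\<lambda>\<omega>. L * \<bar>s - t\<bar> + f (t + Y \<omega>))"
      using mem by (intro E_mono H_intros)
    also have "\<dots> = L * \<bar>s - t\<bar> + E (\<lambda>\<omega>. f (t + Y \<omega>))" by (intro E_add_const mem)
    finally show ?thesis .
  qed
  show ?thesis using le[of s t] le[of t s] by (simp add: abs_minus_commute)
qed

text \<open>Integrate \<open>Y\<^sup>2 \<le> |Y| / \<epsilon> + \<epsilon> |Y|\<^sup>3\<close> and let \<open>\<epsilon>\<close> tend to \<open>0\<close>. Such an interpolation replaces the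
  Hoelder inequality.\<close>

lemma upper_variance_zero:
  assumes Y: "Y \<in> H" and le: "E (\<lambda>\<omega>. \<bar>Y \<omega>\<bar>) \<le> 0"
  shows "upper_variance E Y \<le> 0"
proof -
  have abs: "(\<lambda>\<omega>. \<bar>Y \<omega>\<bar>) \<in> H"
    by (rule lipschitz_mem[of abs 1]) (use Y in auto)
  define K where "K = E (\<lambda>\<omega>. \<bar>Y \<omega>\<bar> * (Y \<omega> * Y \<omega>))"
  have bound: "upper_variance E Y \<le> K * \<epsilon>" if "\<epsilon> > 0" for \<epsilon>
  proof -
    have "(Y \<omega>)\<^sup>2 \<le> (1 / \<epsilon>) * \<bar>Y \<omega>\<bar> + \<epsilon> * (\<bar>Y \<omega>\<bar> * (Y \<omega> * Y \<omega>))" for \<omega>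
    proof -
      define y where "y = \<bar>Y \<omega>\<bar>"
      \<comment> \<open>up to the factor \<open>y / \<epsilon>\<close>, the claim is \<open>t \<le> 1 + t\<^sup>2\<close> for \<open>t = y * \<epsilon>\<close>\<close>
      have "0 \<le> (y * \<epsilon> - 1)\<^sup>2 + y * \<epsilon>" using that by (simp add: y_def)
      then have "y * \<epsilon> \<le> 1 + y * \<epsilon> * (y * \<epsilon>)" by (simp add: power2_eq_square algebra_simps)
      then have "y \<le> 1 / \<epsilon> + \<epsilon> * (y * y)" using that by (simp add: field_simps)
      then have "y * y \<le> y * (1 / \<epsilon> + \<epsilon> * (y * y))" by (rule mult_left_mono) (simp add: y_def)
      moreover have "y * y = Y \<omega> * Y \<omega>" by (simp add: y_def)
      ultimately show ?thesis by (simp add: power2_eq_square algebra_simps flip: y_def)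
    qed
    then have "upper_variance E Y \<le> E (\<lambda>\<omega>. (1 / \<epsilon>) * \<bar>Y \<omega>\<bar> + \<epsilon> * (\<bar>Y \<omega>\<bar> * (Y \<omega> * Y \<omega>)))"
      unfolding upper_variance_def
      by (intro E_mono H_intros abs Y) (simp_all add: power2_eq_square mult_mem Y)
    also have "\<dots> \<le> E (\<lambda>\<omega>. (1 / \<epsilon>) * \<bar>Y \<omega>\<bar>) + E (\<lambda>\<omega>. \<epsilon> * (\<bar>Y \<omega>\<bar> * (Y \<omega> * Y \<omega>)))"
      by (intro E_subadd H_intros abs Y)
    also have "\<dots> = (1 / \<epsilon>) * E (\<lambda>\<omega>. \<bar>Y \<omega>\<bar>) + \<epsilon> * K"
      unfolding K_def using that by (intro arg_cong2[of _ _ _ _ "(+)"] E_pos_homogeneous H_intros abs Y) auto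
    also have "(1 / \<epsilon>) * E (\<lambda>\<omega>. \<bar>Y \<omega>\<bar>) \<le> 0" using le that by (simp add: divide_nonpos_pos)
    finally show ?thesis by (simp add: mult.commute)
  qed
  show ?thesis
  proof (rule ccontr)
    assume "\<not> ?thesis"
    then have p: "upper_variance E Y > 0" by simp
    have "K > 0" using bound[of 1] p by simp
    \<comment> \<open>this \<open>\<epsilon>\<close> makes the bound half of the upper variance\<close>
    then show False using bound[of "upper_variance E Y / (2 * K)"] p by simp
  qed
qed

section \<open>Variance uncertainty and independence in a G-normal vector\<close>

text \<open>Both sides of \<open>X + X' \<sim> sqrt 2 X\<close> tested with \<open>c x\<^sub>p\<close> are multiples of \<open>E[c X\<^sub>p]\<close>, by \<open>2\<close> and by
  \<open>sqrt 2\<close>.\<close>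

lemma G_normal_centred:
  assumes "G_normal E S X" "finite S" "p \<in> S" "X p \<in> H"
  shows "E (X p) = 0" "E (\<lambda>\<omega>. - X p \<omega>) = 0"
proof -
  have *: "E (\<lambda>\<omega>. c * X p \<omega>) = 0" for c
  proof -
    let ?m = "E (\<lambda>\<omega>. c * X p \<omega>)"
    have mem: "(\<lambda>\<omega>. c * X p \<omega>) \<in> H" by (intro H_intros assms)
    have "(\<lambda>x. c * x p) \<in> C_lLip S" using assms by (intro C_lLip_mult C_lLip_const C_lLip_coord)
    from G_normal_twice[OF assms(1) this]
    have "E (\<lambda>\<omega>'. E (\<lambda>\<omega>. c * X p \<omega>' + c * X p \<omega>)) = E (\<lambda>\<omega>. sqrt 2 * (c * X p \<omega>))"
      by (simp add: algebra_simps)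
    moreover have "E (\<lambda>\<omega>. c * X p \<omega>' + c * X p \<omega>) = ?m + c * X p \<omega>'" for \<omega>'
      using E_add_const[OF mem] by simp
    ultimately have "?m + ?m = sqrt 2 * ?m"
      using E_add_const[OF mem] E_pos_homogeneous[OF mem] by simp
    then have "(2 - sqrt 2) * ?m = 0" by (simp add: algebra_simps)
    moreover have "sqrt 2 < 2" using sqrt2_less_2 .
    ultimately show ?thesis by simp
  qed
  show "E (X p) = 0" "E (\<lambda>\<omega>. - X p \<omega>) = 0" using *[of 1] *[of "-1"] by auto
qed

text \<open>This is the obstruction behind both non-independence statements, proved with the test function
  \<open>x\<^sub>p x\<^sub>q\<^sup>2\<close>. Adding an independent copy applies the nonlinear function \<open>g\<close> at two different stages, to \<open>X\<^sub>p\<close>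
  at variance scale \<open>1\<close> and at variance scale \<open>2\<close>, whereas rescaling \<open>X\<close> applies it
  only at scale \<open>2\<close>. The two agree only if \<open>g\<close> is linear or \<open>X\<^sub>p\<close> does not fluctuate.

  The families \<open>U\<close>, \<open>V\<close> only serve to name the pair \<open>X p\<close>, \<open>X q\<close> by indices of any type.\<close>

lemma G_normal_independent_imp_certain_variance:
  assumes G: "G_normal E S X" and S: "finite S" "p \<in> S" "q \<in> S" and mem: "X p \<in> H" "X q \<in> H"
    and ind: "independent_from E {j} V {i} U" and U: "U i = X p" and V: "V j = X q"
    and pos: "0 < upper_variance E (X p)"
  shows "lower_variance E (X q) = upper_variance E (X q)"
proof -
  define \<delta> where "\<delta> = upper_variance E (X q) - lower_variance E (X q)"
  define g where "g c = lower_variance E (X q) * c + \<delta> * max c 0" for c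
  define h where "h s = E (\<lambda>\<omega>. g (s + X p \<omega>))" for s
  have \<delta>: "0 \<le> \<delta>" unfolding \<delta>_def using lower_le_upper_variance mem by simp
  have sq: "E (\<lambda>\<omega>. c * (X q \<omega>)\<^sup>2) = g c" for c
    unfolding g_def \<delta>_def by (rule E_scaled_square[OF mem(2)])
  note centred_p = G_normal_centred[OF G S(1,2) mem(1)]
  note centred_q = G_normal_centred[OF G S(1,3) mem(2)]
  have g_lip: "\<bar>g s - g t\<bar> \<le> (lower_variance E (X q) + \<delta>) * \<bar>s - t\<bar>" for s t
  proof -
    have "g s - g t = lower_variance E (X q) * (s - t) + \<delta> * (max s 0 - max t 0)"
      by (simp add: g_def algebra_simps)
    also have "\<bar>\<dots>\<bar> \<le> lower_variance E (X q) * \<bar>s - t\<bar> + \<delta> * \<bar>max s 0 - max t 0\<bar>"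
      using \<delta> lower_variance_nonneg[OF mem(2)]
      by (metis abs_mult abs_of_nonneg abs_triangle_ineq)
    also have "\<dots> \<le> lower_variance E (X q) * \<bar>s - t\<bar> + \<delta> * \<bar>s - t\<bar>"
      using \<delta> by (intro add_left_mono mult_left_mono) auto
    finally show ?thesis by (simp add: distrib_right)
  qed
  have h_lip: "\<bar>h s - h t\<bar> \<le> (lower_variance E (X q) + \<delta>) * \<bar>s - t\<bar>" for s t
    unfolding h_def by (rule E_shift_lipschitz[OF g_lip mem(1)])
  have g_mem: "(\<lambda>\<omega>. g (s + X p \<omega>)) \<in> H" for s
    by (rule lipschitz_mem[OF g_lip]) (intro H_intros mem)
  have g_mem0: "(\<lambda>\<omega>. g (X p \<omega>)) \<in> H" using g_mem[of 0] by simp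
  have h_mem: "(\<lambda>\<omega>. h (X p \<omega>)) \<in> H"
    by (rule lipschitz_mem[OF h_lip mem(1)])
  have sum_coord: "(\<lambda>x. x (Inl i)) \<in> C_lLip ({i} <+> {j})" "(\<lambda>x. x (Inr j)) \<in> C_lLip ({i} <+> {j})"
    by (auto intro: C_lLip_coord)
  note coord = C_lLip_coord[OF S(1)]
  \<comment> \<open>expectation over the copy of \<open>X q\<close> for a fixed value of everything else: the cross term vanishes\<close>
  have inner: "E (\<lambda>\<omega>. c * (z + X q \<omega>)\<^sup>2) = c * z\<^sup>2 + g c" for c z
  proof -
    have "E (\<lambda>\<omega>. c * (z + X q \<omega>)\<^sup>2) = E (\<lambda>\<omega>. c * z\<^sup>2 + (c * (X q \<omega>)\<^sup>2 + (2 * c * z) * X q \<omega>))"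
      by (simp add: power2_eq_square algebra_simps)
    also have "\<dots> = c * z\<^sup>2 + E (\<lambda>\<omega>. c * (X q \<omega>)\<^sup>2 + (2 * c * z) * X q \<omega>)"
      unfolding power2_eq_square by (intro E_add_const H_intros mem)
    also have "E (\<lambda>\<omega>. c * (X q \<omega>)\<^sup>2 + (2 * c * z) * X q \<omega>) = E (\<lambda>\<omega>. c * (X q \<omega>)\<^sup>2)"
      unfolding power2_eq_square by (intro E_add_centred H_intros mem centred_q)
    finally show ?thesis by (simp add: sq)
  qed
  \<comment> \<open>expectation over the whole copy, at the point \<open>(y, z)\<close>; as \<open>z\<close> is fixed, \<open>z\<^sup>2 * X p\<close> vanishes\<close>
  have step: "E (\<lambda>\<omega>. (y + X p \<omega>) * (z + X q \<omega>)\<^sup>2) = y * z\<^sup>2 + h y" for y z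
  proof -
    have "(\<lambda>x. (y + x (Inl i)) * (z + x (Inr j))\<^sup>2) \<in> C_lLip ({i} <+> {j})"
      unfolding power2_eq_square by (intro C_lLip_mult C_lLip_add C_lLip_const sum_coord)
    from independent_from_pairD[OF ind, of "\<lambda>u v. (y + u) * (z + v)\<^sup>2", OF this]
    have "E (\<lambda>\<omega>. (y + X p \<omega>) * (z + X q \<omega>)\<^sup>2) = E (\<lambda>\<omega>'. (y + X p \<omega>') * z\<^sup>2 + g (y + X p \<omega>'))"
      by (simp add: inner U V)
    also have "\<dots> = E (\<lambda>\<omega>. y * z\<^sup>2 + (g (y + X p \<omega>) + z\<^sup>2 * X p \<omega>))"
      by (simp add: algebra_simps)
    also have "\<dots> = y * z\<^sup>2 + E (\<lambda>\<omega>. g (y + X p \<omega>) + z\<^sup>2 * X p \<omega>)"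
      by (intro E_add_const H_intros g_mem mem)
    also have "E (\<lambda>\<omega>. g (y + X p \<omega>) + z\<^sup>2 * X p \<omega>) = h y"
      unfolding h_def by (intro E_add_centred g_mem mem centred_p)
    finally show ?thesis .
  qed
  \<comment> \<open>needed for \<open>k = 1\<close> (outer expectation after \<open>step\<close>) and for \<open>k = 0\<close> (the rescaled vector)\<close>
  have once: "E (\<lambda>\<omega>. X p \<omega> * (X q \<omega>)\<^sup>2 + k * h (X p \<omega>)) = E (\<lambda>\<omega>. g (X p \<omega>) + k * h (X p \<omega>))" for k
  proof -
    have "(\<lambda>x. x (Inl i) * (x (Inr j))\<^sup>2 + k * h (x (Inl i))) \<in> C_lLip ({i} <+> {j})"
      unfolding power2_eq_square
      by (intro C_lLip_mult C_lLip_add C_lLip_const sum_coord C_lLip_lipschitz_comp[OF h_lip])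
    from independent_from_pairD[OF ind, of "\<lambda>u v. u * v\<^sup>2 + k * h u", OF this]
    have "E (\<lambda>\<omega>. X p \<omega> * (X q \<omega>)\<^sup>2 + k * h (X p \<omega>)) =
        E (\<lambda>\<omega>'. E (\<lambda>\<omega>. k * h (X p \<omega>') + X p \<omega>' * (X q \<omega>)\<^sup>2))"
      by (simp add: U V add.commute)
    also have "(\<lambda>\<omega>'. E (\<lambda>\<omega>. k * h (X p \<omega>') + X p \<omega>' * (X q \<omega>)\<^sup>2)) =
        (\<lambda>\<omega>'. k * h (X p \<omega>') + E (\<lambda>\<omega>. X p \<omega>' * (X q \<omega>)\<^sup>2))"
      unfolding power2_eq_square by (intro ext E_add_const H_intros mem)
    finally show ?thesis by (simp add: sq add.commute)
  qed
  define m where "m = E (\<lambda>\<omega>. g (X p \<omega>))"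
  have hm: "E (\<lambda>\<omega>. h (X p \<omega>)) = sqrt 2 * m"
  proof -
    have "(\<lambda>x. g (x p)) \<in> C_lLip S" by (intro C_lLip_lipschitz_comp[OF g_lip] coord S)
    from G_normal_twice[OF G this]
    have "E (\<lambda>\<omega>. h (X p \<omega>)) = E (\<lambda>\<omega>. g (sqrt 2 * X p \<omega>))" by (simp add: h_def)
    also have "(\<lambda>\<omega>. g (sqrt 2 * X p \<omega>)) = (\<lambda>\<omega>. sqrt 2 * g (X p \<omega>))"
      by (auto simp: g_def algebra_simps max_def mult_le_0_iff)
    finally show ?thesis using E_pos_homogeneous[OF g_mem0, of "sqrt 2"] by (simp add: m_def)
  qed
  have "(\<lambda>x. x p * (x q)\<^sup>2) \<in> C_lLip S"
    unfolding power2_eq_square by (intro C_lLip_mult coord S)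
  from G_normal_twice[OF G this]
  have "E (\<lambda>\<omega>. X p \<omega> * (X q \<omega>)\<^sup>2 + h (X p \<omega>)) = E (\<lambda>\<omega>. sqrt 2 * X p \<omega> * (sqrt 2 * X q \<omega>)\<^sup>2)"
    by (simp only: step)
  also have "\<dots> = E (\<lambda>\<omega>. (2 * sqrt 2) * (X p \<omega> * (X q \<omega>)\<^sup>2))"
    by (simp add: power_mult_distrib algebra_simps)
  also have "\<dots> = (2 * sqrt 2) * E (\<lambda>\<omega>. X p \<omega> * (X q \<omega>)\<^sup>2)"
    unfolding power2_eq_square by (intro E_pos_homogeneous H_intros mem) simp
  finally have "2 * sqrt 2 * m = E (\<lambda>\<omega>. g (X p \<omega>) + h (X p \<omega>))"
    using once[of 0] once[of 1] by (simp add: m_def)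
  also have "\<dots> \<le> m + sqrt 2 * m"
    using E_subadd[OF g_mem0 h_mem] by (simp add: hm m_def)
  finally have "(sqrt 2 - 1) * m \<le> 0" by (simp add: algebra_simps)
  then have m: "m \<le> 0" by (simp add: mult_le_0_iff)
  have plus_mem: "(\<lambda>\<omega>. max (X p \<omega>) 0) \<in> H" by (intro H_intros mem)
  define e where "e = E (\<lambda>\<omega>. max (X p \<omega>) 0)"
  have "m = E (\<lambda>\<omega>. \<delta> * max (X p \<omega>) 0 + lower_variance E (X q) * X p \<omega>)"
    unfolding m_def g_def by (simp add: add.commute)
  also have "\<dots> = E (\<lambda>\<omega>. \<delta> * max (X p \<omega>) 0)"
    by (intro E_add_centred H_intros mem centred_p)
  also have "\<dots> = \<delta> * e" unfolding e_def using \<delta> by (intro E_pos_homogeneous plus_mem)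
  finally have me: "m = \<delta> * e" .
  have "e > 0"
  proof (rule ccontr)
    assume "\<not> e > 0"
    \<comment> \<open>as \<open>X p\<close> is centred, its positive part controls its absolute value\<close>
    have "(\<lambda>\<omega>. \<bar>X p \<omega>\<bar>) = (\<lambda>\<omega>. 2 * max (X p \<omega>) 0 + (- 1) * X p \<omega>)" by (auto simp: fun_eq_iff)
    then have "E (\<lambda>\<omega>. \<bar>X p \<omega>\<bar>) = E (\<lambda>\<omega>. 2 * max (X p \<omega>) 0)"
      by (simp only:) (intro E_add_centred H_intros mem centred_p)
    also have "\<dots> = 2 * e" unfolding e_def by (intro E_pos_homogeneous plus_mem) simp
    finally show False using upper_variance_zero[OF mem(1)] pos \<open>\<not> e > 0\<close> by simp
  qed
  with m me \<delta> have "\<delta> = 0" by (simp add: mult_le_0_iff)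
  then show ?thesis by (simp add: \<delta>_def)
qed

text \<open>Split the form over \<open>{1..k + 1}\<close> as \<open>q + d W\<^sub>k\<^sub>+\<^sub>1 + c W\<^sub>k\<^sub>+\<^sub>1\<^sup>2\<close>, with \<open>q\<close> and \<open>d\<close> functions of the earlier
  variables. Under the inner expectation of independence, \<open>q\<close> is a constant and the middle term is
  centred, so the square contributes a constant that does not depend on the earlier variables.\<close>

lemma E_quadratic_form_independent:
  fixes W :: "nat \<Rightarrow> 'w \<Rightarrow> real"
  assumes mem: "\<And>k. k \<in> {1..n} \<Longrightarrow> W k \<in> H"
    and centred: "\<And>k. k \<in> {1..n} \<Longrightarrow> E (W k) = 0" "\<And>k. k \<in> {1..n} \<Longrightarrow> E (\<lambda>\<omega>. - W k \<omega>) = 0"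
    and ind: "\<And>k. 1 \<le> k \<Longrightarrow> k < n \<Longrightarrow> independent_from E {k + 1} W {1..k} W"
  shows "E (\<lambda>\<omega>. \<Sum>i\<in>{1..n}. \<Sum>j\<in>{1..n}. c i j * (W i \<omega> * W j \<omega>)) =
    (\<Sum>i\<in>{1..n}. E (\<lambda>\<omega>. c i i * (W i \<omega>)\<^sup>2))"
proof -
  have "E (\<lambda>\<omega>. \<Sum>i\<in>{1..k}. \<Sum>j\<in>{1..k}. c i j * (W i \<omega> * W j \<omega>)) =
    (\<Sum>i\<in>{1..k}. E (\<lambda>\<omega>. c i i * (W i \<omega>)\<^sup>2))" if "k \<le> n" for k
    using that
  proof (induction k)
    case 0
    show ?case by (simp add: E_const)
  next
    case (Suc k)
    have memk: "W i \<in> H" if "i \<in> {1..Suc k}" for i using mem that Suc.prems by simp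
    show ?case
    proof (cases "k = 0")
      case True
      then show ?thesis by (simp add: power2_eq_square)
    next
      case False
      define q where "q x = (\<Sum>i\<in>{1..k}. \<Sum>j\<in>{1..k}. c i j * (x i * x j))" for x :: "nat \<Rightarrow> real"
      define d where "d x = (\<Sum>i\<in>{1..k}. (c i (Suc k) + c (Suc k) i) * x i)" for x :: "nat \<Rightarrow> real"
      define f where "f x = q (\<lambda>i. x (Inl i)) + (c (Suc k) (Suc k) * (x (Inr (Suc k)))\<^sup>2
        + d (\<lambda>i. x (Inl i)) * x (Inr (Suc k)))" for x :: "nat + nat \<Rightarrow> real"
      have split: "(\<Sum>i\<in>{1..Suc k}. \<Sum>j\<in>{1..Suc k}. c i j * (x i * x j)) =
          q x + (c (Suc k) (Suc k) * (x (Suc k))\<^sup>2 + d x * x (Suc k))" for x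
        by (simp add: q_def d_def sum.distrib sum_distrib_left sum_distrib_right power2_eq_square algebra_simps)
      have f: "f \<in> C_lLip ({1..k} <+> {Suc k})"
        unfolding f_def q_def d_def power2_eq_square
        by (intro C_lLip_add C_lLip_mult C_lLip_sum C_lLip_const C_lLip_coord) auto
      have q_mem: "(\<lambda>\<omega>. q (\<lambda>i. W i \<omega>)) \<in> H"
        unfolding q_def by (intro H_intros memk) auto
      have W: "W (Suc k) \<in> H" "E (W (Suc k)) = 0" "E (\<lambda>\<omega>. - W (Suc k) \<omega>) = 0"
        using mem[of "Suc k"] centred[of "Suc k"] Suc.prems by auto
      have "independent_from E {k + 1} W {1..k} W" using ind[of k] False Suc.prems by simp
      then have "E (\<lambda>\<omega>. f (case_sum (\<lambda>i. W i \<omega>) (\<lambda>j. W j \<omega>))) =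
          E (\<lambda>\<omega>'. E (\<lambda>\<omega>. f (case_sum (\<lambda>i. W i \<omega>') (\<lambda>j. W j \<omega>))))"
        using f unfolding independent_from_def Suc_eq_plus1 by (rule bspec)
      then have "E (\<lambda>\<omega>. \<Sum>i\<in>{1..Suc k}. \<Sum>j\<in>{1..Suc k}. c i j * (W i \<omega> * W j \<omega>)) =
          E (\<lambda>\<omega>'. E (\<lambda>\<omega>. q (\<lambda>i. W i \<omega>') + (c (Suc k) (Suc k) * (W (Suc k) \<omega>)\<^sup>2
            + d (\<lambda>i. W i \<omega>') * W (Suc k) \<omega>)))"
        by (simp only: split f_def sum.case)
      also have "(\<lambda>\<omega>'. E (\<lambda>\<omega>. q (\<lambda>i. W i \<omega>') + (c (Suc k) (Suc k) * (W (Suc k) \<omega>)\<^sup>2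
            + d (\<lambda>i. W i \<omega>') * W (Suc k) \<omega>))) =
          (\<lambda>\<omega>'. q (\<lambda>i. W i \<omega>') + E (\<lambda>\<omega>. c (Suc k) (Suc k) * (W (Suc k) \<omega>)\<^sup>2
            + d (\<lambda>i. W i \<omega>') * W (Suc k) \<omega>))"
        unfolding power2_eq_square by (intro ext E_add_const H_intros W)
      also have "\<dots> = (\<lambda>\<omega>'. q (\<lambda>i. W i \<omega>') + E (\<lambda>\<omega>. c (Suc k) (Suc k) * (W (Suc k) \<omega>)\<^sup>2))"
        unfolding power2_eq_square by (intro ext arg_cong2[of _ _ _ _ "(+)"] refl E_add_centred H_intros W)
      also have "E \<dots> = E (\<lambda>\<omega>. q (\<lambda>i. W i \<omega>)) + E (\<lambda>\<omega>. c (Suc k) (Suc k) * (W (Suc k) \<omega>)\<^sup>2)"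
        by (subst (1 2) add.commute) (rule E_add_const[OF q_mem])
      also have "E (\<lambda>\<omega>. q (\<lambda>i. W i \<omega>)) = (\<Sum>i\<in>{1..k}. E (\<lambda>\<omega>. c i i * (W i \<omega>)\<^sup>2))"
        unfolding q_def using Suc by simp
      finally show ?thesis by simp
    qed
  qed
  then show ?thesis by simp
qed

end


section \<open>Boxes of diagonal matrices\<close>

lemma sum_sum_delta:
  fixes f :: "'a::finite \<Rightarrow> 'a \<Rightarrow> real"
  shows "(\<Sum>k\<in>UNIV. \<Sum>l\<in>UNIV. if k = i \<and> l = j then f k l else 0) = f i j"
proof -
  have "(\<Sum>l\<in>UNIV. if k = i \<and> l = j then f k l else 0) = (if k = i then f k j else 0)" for k
    by (cases "k = i") simp_all
  then show ?thesis by simp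
qed

lemma trace_matrix_mult:
  fixes A B :: "real ^ 'n ^ 'n"
  shows "trace (A ** B) = (\<Sum>i\<in>UNIV. \<Sum>j\<in>UNIV. A $ i $ j * B $ j $ i)"
  by (simp add: trace_def matrix_matrix_mult_def)

lemma trace_mult_symmetric:
  fixes A B :: "real ^ 'n ^ 'n"
  assumes "transpose B = B"
  shows "trace (A ** B) = A \<bullet> B"
proof -
  have "B $ j $ i = B $ i $ j" for i j using arg_cong[OF assms, of "\<lambda>M. M $ i $ j"] by (simp add: transpose_def)
  then show ?thesis by (simp add: trace_matrix_mult inner_vec_def)
qed

text \<open>The right-hand side of the hypothesis on \<open>SUP\<close> is the support function of the box, because
  \<open>lo * a + (hi - lo) * max a 0\<close> is the largest value of \<open>r * a\<close> for \<open>lo \<le> r \<le> hi\<close>. Symmetric test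
  matrices suffice, since a symmetric \<open>B\<close> sees only the symmetric part of a separating functional.\<close>

lemma box_of_diagonal_matrices_eqI:
  fixes \<Gamma> :: "(real ^ 'n ^ 'n) set" and lo hi :: "'n \<Rightarrow> real"
  assumes \<Gamma>: "\<Gamma> \<noteq> {}" "bounded \<Gamma>" "closed \<Gamma>" "convex \<Gamma>"
    and sym: "\<And>B. B \<in> \<Gamma> \<Longrightarrow> transpose B = B"
    and sup: "\<And>A. transpose A = A \<Longrightarrow> (SUP B\<in>\<Gamma>. trace (A ** B)) =
      (\<Sum>i\<in>UNIV. lo i * A $ i $ i + (hi i - lo i) * max (A $ i $ i) 0)"
  shows "\<Gamma> = {(\<chi> i j. if i = j then r i else 0) | r. \<forall>i. r i \<in> {lo i..hi i}}"
proof (intro set_eqI iffI)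
  fix B assume B: "B \<in> \<Gamma>"
  obtain M where M: "\<And>C. C \<in> \<Gamma> \<Longrightarrow> norm C \<le> M" using \<Gamma>(2) by (auto simp: bounded_iff)
  have le: "trace (A ** B) \<le> (\<Sum>i\<in>UNIV. lo i * A $ i $ i + (hi i - lo i) * max (A $ i $ i) 0)"
    if "transpose A = A" for A
  proof -
    have "trace (A ** C) \<le> norm A * M" if "C \<in> \<Gamma>" for C
    proof -
      have "A \<bullet> C \<le> norm A * norm C" by (rule norm_cauchy_schwarz)
      also have "\<dots> \<le> norm A * M" using M[OF that] by (intro mult_left_mono) auto
      finally show ?thesis using trace_mult_symmetric[OF sym[OF that]] by simp
    qed
    then have "trace (A ** B) \<le> (SUP B\<in>\<Gamma>. trace (A ** B))"
      by (intro cSUP_upper B bdd_aboveI2)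
    then show ?thesis using sup[OF that] by simp
  qed
  have Bsym: "B $ j $ i = B $ i $ j" for i j
    using arg_cong[OF sym[OF B], of "\<lambda>M. M $ i $ j"] by (simp add: transpose_def)
  \<comment> \<open>test with \<open>s\<close> times the sum of two mirrored matrix units: for \<open>i \<noteq> j\<close> both signs of \<open>s\<close> force the
     entry to vanish, for \<open>i = j\<close> they give its upper and lower bound\<close>
  have test: "2 * s * B $ i $ j \<le> (if i = j then lo i * (2 * s) + (hi i - lo i) * max (2 * s) 0 else 0)" for s i j
  proof -
    define A :: "real ^ 'n ^ 'n" where
      "A = (\<chi> k l. (if k = i \<and> l = j then s else 0) + (if k = j \<and> l = i then s else 0))"
    have "transpose A = A"
      unfolding A_def transpose_def vec_eq_iff vec_lambda_beta
      by (intro allI) (simp only: conj_commute add.commute)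
    note le[OF this]
    also have "trace (A ** B) = 2 * s * B $ i $ j"
    proof -
      have pull: "(if P then s else 0) * c = (if P then s * c else 0)" for P and c :: real by simp
      have "trace (A ** B) = (\<Sum>k\<in>UNIV. \<Sum>l\<in>UNIV. if k = i \<and> l = j then s * B $ l $ k else 0)
         + (\<Sum>k\<in>UNIV. \<Sum>l\<in>UNIV. if k = j \<and> l = i then s * B $ l $ k else 0)"
        unfolding trace_matrix_mult A_def sum.distrib[symmetric]
        by (simp only: vec_lambda_beta distrib_right pull)
      also have "\<dots> = s * B $ j $ i + s * B $ i $ j" by (simp only: sum_sum_delta)
      also have "\<dots> = 2 * s * B $ i $ j" unfolding Bsym[of i j] by simp
      finally show ?thesis .
    qed
    also have "(\<Sum>k\<in>UNIV. lo k * A $ k $ k + (hi k - lo k) * max (A $ k $ k) 0) =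
        (\<Sum>k\<in>UNIV. if k = i then (if i = j then lo i * (2 * s) + (hi i - lo i) * max (2 * s) 0 else 0) else 0)"
      by (intro sum.cong refl) (auto simp: A_def)
    finally show ?thesis by simp
  qed
  have "B $ i $ j = 0" if "i \<noteq> j" for i j
    using test[of 1 i j] test[of "-1" i j] that by simp
  moreover have "B $ i $ i \<in> {lo i..hi i}" for i
    using test[of "1/2" i i] test[of "-1/2" i i] by simp
  ultimately show "B \<in> {(\<chi> i j. if i = j then r i else 0) | r. \<forall>i. r i \<in> {lo i..hi i}}"
    by (intro CollectI exI[of _ "\<lambda>i. B $ i $ i"]) (auto simp: vec_eq_iff)
next
  fix D :: "real ^ 'n ^ 'n" assume "D \<in> {(\<chi> i j. if i = j then r i else 0) | r. \<forall>i. r i \<in> {lo i..hi i}}"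
  then obtain r where D: "D = (\<chi> i j. if i = j then r i else 0)" and r: "\<And>i. lo i \<le> r i" "\<And>i. r i \<le> hi i"
    by auto
  show "D \<in> \<Gamma>"
  proof (rule ccontr)
    assume "D \<notin> \<Gamma>"
    then obtain a b where ab: "a \<bullet> D < b" "\<And>B. B \<in> \<Gamma> \<Longrightarrow> b < a \<bullet> B"
      using separating_hyperplane_closed_point[OF \<Gamma>(4,3)] by blast
    \<comment> \<open>minus the symmetric part of the separating functional \<open>a\<close>; the sign turns a lower bound on \<open>\<Gamma>\<close> into
       a bound on the supremum\<close>
    define A :: "real ^ 'n ^ 'n" where "A = (\<chi> i j. - (a $ i $ j + a $ j $ i) / 2)"
    have A: "transpose A = A" by (simp add: A_def transpose_def vec_eq_iff add.commute)
    have tr: "trace (A ** B) = - (a \<bullet> B)" if "transpose B = B" for B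
    proof -
      have Bs: "B $ j $ i = B $ i $ j" for i j
        using arg_cong[OF that, of "\<lambda>M. M $ i $ j"] by (simp add: transpose_def)
      have "(\<Sum>i\<in>UNIV. \<Sum>j\<in>UNIV. a $ j $ i * B $ j $ i) = a \<bullet> B"
        by (subst sum.swap) (simp add: inner_vec_def)
      moreover have "(\<Sum>i\<in>UNIV. \<Sum>j\<in>UNIV. a $ i $ j * B $ j $ i) = a \<bullet> B"
        by (simp add: inner_vec_def Bs)
      moreover have "trace (A ** B) = - ((\<Sum>i\<in>UNIV. \<Sum>j\<in>UNIV. a $ i $ j * B $ j $ i)
          + (\<Sum>i\<in>UNIV. \<Sum>j\<in>UNIV. a $ j $ i * B $ j $ i)) / 2"
        unfolding trace_matrix_mult A_def sum.distrib[symmetric] sum_negf[symmetric] sum_divide_distrib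
        by (intro sum.cong refl) (simp add: algebra_simps)
      ultimately show ?thesis by simp
    qed
    have "trace (A ** B) \<le> - b" if "B \<in> \<Gamma>" for B
      using ab(2)[OF that] tr[OF sym[OF that]] by simp
    then have "(SUP B\<in>\<Gamma>. trace (A ** B)) \<le> - b" by (intro cSUP_least \<Gamma>(1))
    also have "\<dots> < - (a \<bullet> D)" using ab(1) by simp
    also have "\<dots> = trace (A ** D)" by (subst tr) (auto simp: D transpose_def vec_eq_iff)
    also have "\<dots> = (\<Sum>i\<in>UNIV. A $ i $ i * r i)"
      by (simp add: trace_matrix_mult D if_distrib[of "(*) _"] cong: if_cong)
    also have "\<dots> \<le> (\<Sum>i\<in>UNIV. lo i * A $ i $ i + (hi i - lo i) * max (A $ i $ i) 0)"
    proof (rule sum_mono)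
      fix i
      have "0 \<le> (hi i - r i) * max (A $ i $ i) 0 + (r i - lo i) * (max (A $ i $ i) 0 - A $ i $ i)"
        using r[of i] by simp
      then show "A $ i $ i * r i \<le> lo i * A $ i $ i + (hi i - lo i) * max (A $ i $ i) 0"
        by (simp add: algebra_simps)
    qed
    finally show False using sup[OF A] by simp
  qed
qed

section \<open>The covariance set and non-independence\<close>

theorem theorem4p5:
  fixes H :: "('w \<Rightarrow> real) set" and E :: "('w \<Rightarrow> real) \<Rightarrow> real"
    and X :: "'n::finite \<Rightarrow> 'w \<Rightarrow> real" and \<Gamma> :: "(real ^ 'n ^ 'n) set"
    and \<pi> :: "nat \<Rightarrow> 'n" and lo hi :: "'n \<Rightarrow> real"
  defines "lo \<equiv> \<lambda>i. lower_variance E (X i)" and "hi \<equiv> \<lambda>i. upper_variance E (X i)"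
  assumes "sublinear_expectation_space H E"
    and "\<And>i. X i \<in> H"
    and "normal_distributed E X \<Gamma>"
    and "bij_betw \<pi> {1..CARD('n)} UNIV"
    and "\<And>i. 1 \<le> i \<Longrightarrow> i \<le> CARD('n) - 1 \<Longrightarrow>
           independent_from E {i + 1} (\<lambda>k. X (\<pi> k)) {1..i} (\<lambda>k. X (\<pi> k))"
  shows "\<Gamma> = {(\<chi> i j. if i = j then r i else 0) | r. \<forall>i. r i \<in> {lo i..hi i}}
    \<and> (\<forall>i. 0 < lo i \<and> lo i < hi i \<longrightarrow>
           (\<forall>j. j \<noteq> i \<longrightarrow> (\<forall>\<alpha>>0. {\<alpha> * lo i..\<alpha> * hi i} \<noteq> {lo j..hi j})))
    \<and> (\<forall>i j. 1 \<le> i \<and> i < j \<and> j \<le> CARD('n) \<and>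
           (lo (\<pi> i) < hi (\<pi> i) \<and> 0 < hi (\<pi> j) \<or> lo (\<pi> j) < hi (\<pi> j) \<and> 0 < hi (\<pi> i)) \<longrightarrow>
           \<not> independent_from E {i} (\<lambda>k. X (\<pi> k)) {j} (\<lambda>k. X (\<pi> k)))"
proof -
  interpret sublinear_expectation_space H E by fact
  note mem = assms(4)
  define n where "n = CARD('n)"
  define W where "W k = X (\<pi> k)" for k
  have \<pi>: "bij_betw \<pi> {1..n} UNIV" using assms(6) by (simp add: n_def)
  have ind: "independent_from E {k + 1} W {1..k} W" if "1 \<le> k" "k < n" for k
    using assms(7)[of k] that by (simp add: n_def W_def[abs_def])
  from assms(5) have G: "G_normal E UNIV X"
    and \<Gamma>: "\<Gamma> \<noteq> {}" "bounded \<Gamma>" "closed \<Gamma>" "convex \<Gamma>" "\<And>B. B \<in> \<Gamma> \<Longrightarrow> transpose B = B"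
    and sup: "\<And>A. transpose A = A \<Longrightarrow>
        (SUP B\<in>\<Gamma>. trace (A ** B)) = E (\<lambda>\<omega>. (A *v (\<chi> i. X i \<omega>)) \<bullet> (\<chi> i. X i \<omega>))"
    by (auto simp: normal_distributed_def pos_semidef_def)
  have centred: "E (X i) = 0" "E (\<lambda>\<omega>. - X i \<omega>) = 0" for i
    using G_normal_centred[OF G _ _ mem, of i] by auto
  have support: "(SUP B\<in>\<Gamma>. trace (A ** B)) =
      (\<Sum>i\<in>UNIV. lo i * A $ i $ i + (hi i - lo i) * max (A $ i $ i) 0)" if "transpose A = A" for A
  proof -
    have form: "(A *v x) \<bullet> x = (\<Sum>k\<in>{1..n}. \<Sum>l\<in>{1..n}. A $ \<pi> k $ \<pi> l * (x $ \<pi> k * x $ \<pi> l))" for x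
    proof -
      have "(A *v x) \<bullet> x = (\<Sum>i\<in>UNIV. \<Sum>j\<in>UNIV. A $ i $ j * (x $ i * x $ j))"
        by (simp add: inner_vec_def matrix_vector_mult_def sum_distrib_left sum_distrib_right algebra_simps)
      then show ?thesis
        by (simp only: sum.reindex_bij_betw[OF \<pi>, symmetric])
    qed
    have "E (\<lambda>\<omega>. (A *v (\<chi> i. X i \<omega>)) \<bullet> (\<chi> i. X i \<omega>)) =
        E (\<lambda>\<omega>. \<Sum>k\<in>{1..n}. \<Sum>l\<in>{1..n}. A $ \<pi> k $ \<pi> l * (W k \<omega> * W l \<omega>))"
      by (simp add: form W_def)
    also have "\<dots> = (\<Sum>k\<in>{1..n}. E (\<lambda>\<omega>. A $ \<pi> k $ \<pi> k * (W k \<omega>)\<^sup>2))"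
      by (intro E_quadratic_form_independent ind) (simp_all add: W_def mem centred)
    also have "\<dots> = (\<Sum>i\<in>UNIV. E (\<lambda>\<omega>. A $ i $ i * (X i \<omega>)\<^sup>2))"
      unfolding W_def by (rule sum.reindex_bij_betw[OF \<pi>])
    finally show ?thesis
      using sup[OF that] by (simp add: E_scaled_square[OF mem] lo_def hi_def)
  qed
  have pair: "independent_from E {l} W {k} W" if "1 \<le> k" "k < l" "l \<le> n" for k l
    using ind[of "l - 1"] that by (auto intro: independent_from_mono[of E "{l}" W "{1..l - 1}"])
  have certain: "lo (\<pi> l) = hi (\<pi> l)"
    if "independent_from E {l} W {k} W" "0 < hi (\<pi> k)" for k l
    unfolding lo_def hi_def
    using that by (intro G_normal_independent_imp_certain_variance[OF G, of "\<pi> k" "\<pi> l" l W k W])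
      (simp_all add: mem W_def hi_def)
  show ?thesis
  proof (intro conjI allI impI)
    show "\<Gamma> = {(\<chi> i j. if i = j then r i else 0) | r. \<forall>i. r i \<in> {lo i..hi i}}"
      using box_of_diagonal_matrices_eqI[OF \<Gamma> support] .
  next
    fix i j \<alpha> assume i: "0 < lo i \<and> lo i < hi i" and "j \<noteq> i" and \<alpha>: "(0::real) < \<alpha>"
    show "{\<alpha> * lo i..\<alpha> * hi i} \<noteq> {lo j..hi j}"
    proof
      assume "{\<alpha> * lo i..\<alpha> * hi i} = {lo j..hi j}"
      then have j: "lo j = \<alpha> * lo i" "hi j = \<alpha> * hi i" using i \<alpha> by (auto simp: Icc_eq_Icc)
      then have j': "lo j < hi j" "0 < hi j" using i \<alpha> by auto
      obtain k l where kl: "k \<in> {1..n}" "l \<in> {1..n}" "i = \<pi> k" "j = \<pi> l"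
        using \<pi> by (metis UNIV_I bij_betw_imp_surj_on imageE)
      then consider "k < l" | "l < k" using \<open>j \<noteq> i\<close> by (metis linorder_neqE_nat)
      then show False
      proof cases
        case 1
        then show ?thesis using certain[OF pair[of k l]] kl i j' by auto
      next
        case 2
        then show ?thesis using certain[OF pair[of l k]] kl i j' by auto
      qed
    qed
  next
    fix i j
    assume *: "1 \<le> i \<and> i < j \<and> j \<le> CARD('n) \<and>
      (lo (\<pi> i) < hi (\<pi> i) \<and> 0 < hi (\<pi> j) \<or> lo (\<pi> j) < hi (\<pi> j) \<and> 0 < hi (\<pi> i))"
    show "\<not> independent_from E {i} (\<lambda>k. X (\<pi> k)) {j} (\<lambda>k. X (\<pi> k))"
    proof
      assume "independent_from E {i} (\<lambda>k. X (\<pi> k)) {j} (\<lambda>k. X (\<pi> k))"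
      then have "independent_from E {i} W {j} W" by (simp add: W_def[abs_def])
      then show False using certain[of i j] certain[OF pair[of i j]] * by (auto simp: n_def)
    qed
  qed
qed

end
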